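(* Let $\rho_0 \in [\tfrac12,1)$ and let $Y, Y_1, Y_2, \ldots$ be i.i.d. symmetric real random variables with $\mathbb{P}(Y = 0) = \rho_0$ and $\mathbb{E}|Y|^2 < \infty$. For $p \geq 1$ and $a = (a_1,\ldots,a_n) \in \mathbb{R}^n$, define $N_p(a) = \left\|\sum_{i=1}^n a_i Y_i\right\|_p$. The best (i.e. largest) constant $c_1$ such that the inequality $N_1(a) \geq c_1 N_2(a)$ holds for all positive integers $n$ and all $a \in \mathbb{R}^n$ is $c_1 = \|Y\|_1/\|Y\|_2$.
   Context: For a random variable $Z$, $\|Z\|_p = (\mathbb{E}|Z|^p)^{1/p}$. A random variable $Y$ is symmetric if $-Y$ has the same distribution as $Y$. *)

theory Defs
  imports "HOL-Probability.Probability"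
begin

(* Integrals are Bochner integrals, so this is the genuine p-norm only if |Z| powr p is
   integrable. *)
definition Lp_norm :: "'a measure \<Rightarrow> real \<Rightarrow> ('a \<Rightarrow> real) \<Rightarrow> real" where
  "Lp_norm M p Z = (\<integral>\<omega>. \<bar>Z \<omega>\<bar> powr p \<partial>M) powr (1 / p)"

definition symmetric_rv :: "'a measure \<Rightarrow> ('a \<Rightarrow> real) \<Rightarrow> bool" where
  "symmetric_rv M Z \<longleftrightarrow> distr M borel (\<lambda>\<omega>. - Z \<omega>) = distr M borel Z"

definition iid :: "'a measure \<Rightarrow> (nat \<Rightarrow> 'a \<Rightarrow> real) \<Rightarrow> bool" where
  "iid M Y \<longleftrightarrow> prob_space.indep_vars M (\<lambda>_. borel) Y UNIV \<and>
     (\<forall>i j. distr M borel (Y i) = distr M borel (Y j))"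

(* A vector of length n is a function on nat of which only the values at 1, ..., n are used. *)
definition N :: "'a measure \<Rightarrow> (nat \<Rightarrow> 'a \<Rightarrow> real) \<Rightarrow> real \<Rightarrow> nat \<Rightarrow> (nat \<Rightarrow> real) \<Rightarrow> real" where
  "N M Y p n a = Lp_norm M p (\<lambda>\<omega>. \<Sum>i=1..n. a i * Y i \<omega>)"

definition is_largest :: "real \<Rightarrow> (real \<Rightarrow> bool) \<Rightarrow> bool" where
  "is_largest c P \<longleftrightarrow> P c \<and> (\<forall>c'. P c' \<longrightarrow> c' \<le> c)"

end

theory Submission
  imports Defs
begin

text \<open>
Since \<open>P(Y = 0) \<ge> 1/2\<close>, the law of \<open>Y\<close> is that of \<open>R (\<epsilon> + \<epsilon>') / 2\<close> with \<open>R\<close> independent of the two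
fair signs: the factor \<open>(\<epsilon> + \<epsilon>') / 2\<close> already vanishes with probability 1/2, and the law of \<open>R\<close> is
obtained from that of \<open>Y\<close> by a change of density which lowers the atom at 0 to \<open>2 \<rho> - 1\<close> and doubles
the rest. Given the \<open>R\<^sub>i\<close>, the sum \<open>\<Sum> a\<^sub>i Y\<^sub>i\<close> becomes a Rademacher sum in which every coefficient
\<open>a\<^sub>i R\<^sub>i / 2\<close> occurs twice, and Szarek's inequality with its constant \<open>1 / sqrt 2\<close> bounds its first
absolute moment below by \<open>sqrt (\<Sum> a\<^sub>i\<^sup>2 R\<^sub>i\<^sup>2) / 2\<close>. By Cauchy-Schwarz this is at least
\<open>\<Sum> a\<^sub>i\<^sup>2 \<bar>R\<^sub>i\<bar> / (2 \<bar>a\<bar>)\<close>, whose mean is \<open>\<bar>a\<bar> E\<bar>Y\<bar>\<close> as \<open>E\<bar>R\<bar> = 2 E\<bar>Y\<bar>\<close>.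
Szarek's inequality is proved by the Latala-Oleszkiewicz argument: an even function on the discrete
cube has spectral gap 2, whereas the Laplacian of \<open>\<bar>\<Sum> b\<^sub>i \<epsilon>\<^sub>i\<bar>\<close> is pointwise at most the function.
The single vector \<open>a = (1)\<close> shows that the constant cannot be improved.
\<close>

subsection \<open>Szarek's inequality on the discrete cube\<close>

text \<open>A point of the cube \<open>{-1,1}^I\<close> is coded by the set of its coordinates equal
  to 1. The antipode of \<open>A\<close> is then \<open>I - A\<close>.\<close>

definition flip :: "'i \<Rightarrow> 'i set \<Rightarrow> 'i set" where
  "flip i A = (if i \<in> A then A - {i} else insert i A)"

definition sgn_of :: "'i set \<Rightarrow> 'i \<Rightarrow> real" where
  "sgn_of A i = (if i \<in> A then 1 else - 1)"

lemma sgn_of_flip: "sgn_of (flip i A) j = (if j = i then - sgn_of A j else sgn_of A j)"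
  by (cases "j = i") (simp_all add: sgn_of_def flip_def)

lemma sum_Pow_insert:
  assumes "finite I" "k \<notin> I"
  shows "(\<Sum>A\<in>Pow (insert k I). g A) = (\<Sum>A\<in>Pow I. g A + (g (insert k A) :: 'b::comm_monoid_add))"
proof -
  have "inj_on (insert k) (Pow I)"
    using assms by (auto simp: inj_on_def)
  moreover have "Pow I \<inter> insert k ` Pow I = {}"
    using assms by auto
  ultimately show ?thesis
    using assms by (simp add: Pow_insert sum.union_disjoint sum.reindex sum.distrib)
qed

lemma sum_Pow_flip:
  assumes "i \<in> I"
  shows "(\<Sum>A\<in>Pow I. g (flip i A)) = (\<Sum>A\<in>Pow I. g A)"
  using assms by (intro sum.reindex_bij_witness[of _ "flip i" "flip i"]) (auto simp: flip_def)

lemma sum_Pow_compl: "(\<Sum>A\<in>Pow I. g (I - A)) = (\<Sum>A\<in>Pow I. g A)"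
  by (intro sum.reindex_bij_witness[of _ "\<lambda>A. I - A" "\<lambda>A. I - A"]) (auto simp: double_diff)

text \<open>For an even function the left-hand side is twice the (unnormalised) variance. The term with the
odd part makes the statement stable under induction on the dimension.\<close>

lemma cube_poincare:
  fixes f :: "'i set \<Rightarrow> real"
  assumes "finite I"
  shows "2 * (\<Sum>A\<in>Pow I. (f A)\<^sup>2) - 2 * (\<Sum>A\<in>Pow I. f A)\<^sup>2 / 2 ^ card I
           - (\<Sum>A\<in>Pow I. ((f A - f (I - A)) / 2)\<^sup>2)
         \<le> (\<Sum>A\<in>Pow I. \<Sum>i\<in>I. (f A - f (flip i A))\<^sup>2 / 4)"
  using assms
proof (induction I arbitrary: f rule: finite_induct)
  case empty
  show ?case by simp
next
  case (insert k I)
  \<comment> \<open>On the two facets in direction \<open>k\<close>, \<open>f\<close> equals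
    \<open>u + v\<close> and \<open>u - v\<close>. \<open>En\<close> is the Dirichlet form;
    \<open>Od\<close> and \<open>Ev\<close> are the squared norms of the odd and the even part under
    the antipodal map.\<close>
  define u where "u A = (f (insert k A) + f A) / 2" for A
  define v where "v A = (f (insert k A) - f A) / 2" for A
  define En where "En g = (\<Sum>A\<in>Pow I. \<Sum>i\<in>I. (g A - g (flip i A))\<^sup>2 / 4)" for g :: "'i set \<Rightarrow> real"
  define Od where "Od g = (\<Sum>A\<in>Pow I. ((g A - g (I - A)) / 2)\<^sup>2)" for g :: "'i set \<Rightarrow> real"
  define Ev where "Ev g = (\<Sum>A\<in>Pow I. ((g A + g (I - A)) / 2)\<^sup>2)" for g :: "'i set \<Rightarrow> real"
  have f0: "f A = u A - v A" and f1: "f (insert k A) = u A + v A" for A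
    by (simp_all add: u_def v_def field_simps)
  have sq: "(\<Sum>A\<in>Pow (insert k I). (f A)\<^sup>2)
      = 2 * (\<Sum>A\<in>Pow I. (u A)\<^sup>2) + 2 * (\<Sum>A\<in>Pow I. (v A)\<^sup>2)"
    unfolding sum_Pow_insert[OF insert(1,2)] f1 unfolding f0 sum_distrib_left sum.distrib[symmetric]
    by (intro sum.cong) (auto simp: power2_eq_square algebra_simps)
  have mean: "(\<Sum>A\<in>Pow (insert k I). f A) = 2 * (\<Sum>A\<in>Pow I. u A)"
    unfolding sum_Pow_insert[OF insert(1,2)] f1 unfolding f0 sum_distrib_left by simp
  \<comment> \<open>The antipodal map also exchanges the two facets, so \<open>u\<close> enters with
    its odd part but \<open>v\<close> with its even part.\<close>
  have odd: "(\<Sum>A\<in>Pow (insert k I). ((f A - f (insert k I - A)) / 2)\<^sup>2) = 2 * Od u + 2 * Ev v"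
  proof -
    have "insert k I - A = insert k (I - A)" "insert k I - insert k A = I - A" if "A \<in> Pow I" for A
      using that insert(2) by auto
    then show ?thesis
      unfolding sum_Pow_insert[OF insert(1,2)] Od_def Ev_def sum_distrib_left sum.distrib[symmetric] f1
      by (intro sum.cong) (auto simp: f1, auto simp: f0 power2_eq_square field_simps)
  qed
  \<comment> \<open>Adding the two facets cancels the cross terms between \<open>u\<close> and
    \<open>v\<close>. The flips of \<open>k\<close> itself contribute the squares of
    \<open>v\<close>.\<close>
  have energy: "(\<Sum>A\<in>Pow (insert k I). \<Sum>i\<in>insert k I. (f A - f (flip i A))\<^sup>2 / 4)
      = 2 * En u + 2 * En v + 2 * (\<Sum>A\<in>Pow I. (v A)\<^sup>2)"
  proof -
    have "(\<Sum>i\<in>insert k I. (f A - f (flip i A))\<^sup>2 / 4)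
        + (\<Sum>i\<in>insert k I. (f (insert k A) - f (flip i (insert k A)))\<^sup>2 / 4)
      = 2 * (\<Sum>i\<in>I. (u A - u (flip i A))\<^sup>2 / 4) + 2 * (\<Sum>i\<in>I. (v A - v (flip i A))\<^sup>2 / 4)
        + 2 * (v A)\<^sup>2" (is "?L = ?R") if A: "A \<in> Pow I" for A
    proof -
      have k: "flip k A = insert k A" "flip k (insert k A) = A"
        using A insert(2) by (auto simp: flip_def)
      have fl: "flip i (insert k A) = insert k (flip i A)" if "i \<in> I" for i
        using that A insert(2) by (auto simp: flip_def)
      have "?L = (f A - f (insert k A))\<^sup>2 / 2
         + (\<Sum>i\<in>I. (f A - f (flip i A))\<^sup>2 / 4 + (f (insert k A) - f (insert k (flip i A)))\<^sup>2 / 4)"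
        using insert(1,2) by (simp add: k fl sum.distrib power2_commute cong: sum.cong)
      also have "\<dots> = 2 * (v A)\<^sup>2
         + (\<Sum>i\<in>I. 2 * ((u A - u (flip i A))\<^sup>2 / 4) + 2 * ((v A - v (flip i A))\<^sup>2 / 4))"
      proof -
        have "(f A - f (insert k A))\<^sup>2 / 2 = 2 * (v A)\<^sup>2"
          unfolding f1 unfolding f0 by (simp add: power2_eq_square field_simps)
        moreover have "(f A - f (flip i A))\<^sup>2 / 4 + (f (insert k A) - f (insert k (flip i A)))\<^sup>2 / 4
            = 2 * ((u A - u (flip i A))\<^sup>2 / 4) + 2 * ((v A - v (flip i A))\<^sup>2 / 4)" for i
          unfolding f1 unfolding f0 by (simp add: power2_eq_square field_simps)
        ultimately show ?thesis by simp
      qed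
      finally show ?thesis
        by (simp add: sum.distrib sum_distrib_left)
    qed
    then show ?thesis
      unfolding sum_Pow_insert[OF insert(1,2)] En_def sum_distrib_left
      by (simp add: sum.distrib sum_distrib_left)
  qed
  have split: "(\<Sum>A\<in>Pow I. (v A)\<^sup>2) = Od v + Ev v"
  proof -
    have "2 * (Od v + Ev v) = (\<Sum>A\<in>Pow I. (v A)\<^sup>2 + (v (I - A))\<^sup>2)"
      unfolding Od_def Ev_def sum_distrib_left sum.distrib[symmetric]
      by (intro sum.cong) (auto simp: power2_eq_square field_simps)
    also have "\<dots> = 2 * (\<Sum>A\<in>Pow I. (v A)\<^sup>2)"
      using sum_Pow_compl[of "\<lambda>A. (v A)\<^sup>2" I] by (simp add: sum.distrib)
    finally show ?thesis by simp
  qed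
  \<comment> \<open>\<open>v\<close> and its even part have the same sum; then Cauchy-Schwarz
    against the constant 1.\<close>
  have mv: "(\<Sum>A\<in>Pow I. v A)\<^sup>2 / 2 ^ card I \<le> Ev v"
  proof -
    have "(\<Sum>A\<in>Pow I. v A) = (\<Sum>A\<in>Pow I. (v A + v (I - A)) / 2 * 1)"
      using sum_Pow_compl[of v I] by (simp add: sum.distrib flip: sum_divide_distrib)
    then have "(\<Sum>A\<in>Pow I. v A)\<^sup>2 \<le> Ev v * (\<Sum>A\<in>Pow I. 1\<^sup>2)"
      unfolding Ev_def by (simp only: Cauchy_Schwarz_ineq_sum)
    then show ?thesis
      using insert(1) by (simp add: card_Pow field_simps)
  qed
  \<comment> \<open>The hypothesis for \<open>u\<close> reduces the claim to
    \<open>Od v \<le> En v\<close>. This follows from the hypothesis for \<open>v\<close>, whose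
    left-hand side is at least \<open>Od v\<close> by \<open>split\<close> and
    \<open>mv\<close>.\<close>
  have "2 * (\<Sum>A\<in>Pow I. (g A)\<^sup>2) - 2 * (\<Sum>A\<in>Pow I. g A)\<^sup>2 / 2 ^ card I - Od g \<le> En g" for g
    using insert.IH by (simp add: Od_def En_def)
  from this[of u] this[of v] show ?case
    unfolding sq mean odd energy using split mv insert(1,2)
    by (simp add: power_mult_distrib)
qed

text \<open>The signs are orthonormal under the uniform measure: summing over the two values of sign
  \<open>k\<close> cancels its cross term with the others.\<close>

lemma sum_Pow_sgn_square:
  fixes b :: "'i \<Rightarrow> real"
  assumes "finite I"
  shows "(\<Sum>A\<in>Pow I. (\<Sum>i\<in>I. b i * sgn_of A i)\<^sup>2) = 2 ^ card I * (\<Sum>i\<in>I. (b i)\<^sup>2)"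
  using assms
proof (induction I rule: finite_induct)
  case empty
  show ?case by simp
next
  case (insert k I)
  have "(\<Sum>i\<in>insert k I. b i * sgn_of A i)\<^sup>2 + (\<Sum>i\<in>insert k I. b i * sgn_of (insert k A) i)\<^sup>2
      = 2 * (b k)\<^sup>2 + 2 * (\<Sum>i\<in>I. b i * sgn_of A i)\<^sup>2" if "A \<in> Pow I" for A
  proof -
    have "(\<Sum>i\<in>I. b i * sgn_of (insert k A) i) = (\<Sum>i\<in>I. b i * sgn_of A i)"
      using insert(2) by (intro sum.cong) (auto simp: sgn_of_def)
    moreover have "sgn_of A k = - 1" "sgn_of (insert k A) k = 1"
      using that insert(2) by (auto simp: sgn_of_def)
    ultimately show ?thesis
      using insert(1,2) by (simp add: power2_eq_square algebra_simps)
  qed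
  then show ?case
    using insert by (simp add: sum_Pow_insert sum.distrib card_Pow algebra_simps flip: sum_distrib_left)
qed

text \<open>For the even function \<open>\<bar>X\<bar>\<close> the odd part in
  \<open>cube_poincare\<close> vanishes, and its Dirichlet form is at most the sum of the squares of
  \<open>X\<close>. Hence the second moment of \<open>X\<close> is at most twice the squared mean of
  \<open>\<bar>X\<bar>\<close>.\<close>

lemma szarek:
  fixes b :: "'i \<Rightarrow> real"
  assumes "finite I"
  shows "sqrt (\<Sum>i\<in>I. (b i)\<^sup>2) / sqrt 2 \<le> (\<Sum>A\<in>Pow I. \<bar>\<Sum>i\<in>I. b i * sgn_of A i\<bar>) / 2 ^ card I"
proof -
  define X where "X A = (\<Sum>i\<in>I. b i * sgn_of A i)" for A
  have even: "\<bar>X (I - A)\<bar> = \<bar>X A\<bar>" if "A \<in> Pow I" for A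
  proof -
    have "X (I - A) = - X A"
      unfolding X_def sum_negf[symmetric] by (intro sum.cong) (auto simp: sgn_of_def)
    then show ?thesis by simp
  qed
  \<comment> \<open>The flip of \<open>i\<close> changes \<open>X A\<close> by twice its
    \<open>i\<close>-th term, so all flips together sum to \<open>card I - 2\<close> times
    \<open>X A\<close>. This factor may be negative, which only helps.\<close>
  have flips: "(real (card I) - 2) * \<bar>X A\<bar> \<le> (\<Sum>i\<in>I. \<bar>X (flip i A)\<bar>)" for A
  proof -
    have "X (flip i A) = X A - 2 * (b i * sgn_of A i)" if "i \<in> I" for i
    proof -
      have "(\<Sum>j\<in>I - {i}. b j * sgn_of (flip i A) j) = (\<Sum>j\<in>I - {i}. b j * sgn_of A j)"
        by (rule sum.cong[OF refl]) (simp add: sgn_of_flip)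
      then show ?thesis
        unfolding X_def sum.remove[OF assms that] by (simp add: sgn_of_flip)
    qed
    then have "(\<Sum>i\<in>I. X (flip i A)) = (\<Sum>i\<in>I. X A - 2 * (b i * sgn_of A i))"
      by (rule sum.cong[OF refl])
    also have "\<dots> = (real (card I) - 2) * X A"
      unfolding sum_subtractf sum_distrib_left[symmetric] X_def[symmetric] by (simp add: left_diff_distrib)
    finally have "(\<Sum>i\<in>I. X (flip i A)) = (real (card I) - 2) * X A" .
    then have "(real (card I) - 2) * \<bar>X A\<bar> \<le> \<bar>\<Sum>i\<in>I. X (flip i A)\<bar>"
      by (simp add: abs_mult mult_right_mono)
    then show ?thesis
      using sum_abs order_trans by blast
  qed
  \<comment> \<open>Summation by parts: since flips preserve sums over the cube, the Dirichlet form
    becomes a sum of \<open>\<bar>X A\<bar>\<close> times its Laplacian, which \<open>flips\<close>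
    bounds pointwise.\<close>
  have "(\<Sum>A\<in>Pow I. \<Sum>i\<in>I. (\<bar>X A\<bar> - \<bar>X (flip i A)\<bar>)\<^sup>2 / 4)
      = (\<Sum>i\<in>I. \<Sum>A\<in>Pow I. ((X A)\<^sup>2 - 2 * (\<bar>X A\<bar> * \<bar>X (flip i A)\<bar>) + (X (flip i A))\<^sup>2) / 4)"
    by (subst sum.swap) (simp add: power2_diff algebra_simps)
  also have "\<dots> = (\<Sum>i\<in>I. \<Sum>A\<in>Pow I. ((X A)\<^sup>2 - \<bar>X A\<bar> * \<bar>X (flip i A)\<bar>) / 2)"
  proof (rule sum.cong[OF refl])
    fix i assume "i \<in> I"
    then have "(\<Sum>A\<in>Pow I. (X (flip i A))\<^sup>2) = (\<Sum>A\<in>Pow I. (X A)\<^sup>2)"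
      by (rule sum_Pow_flip)
    then show "(\<Sum>A\<in>Pow I. ((X A)\<^sup>2 - 2 * (\<bar>X A\<bar> * \<bar>X (flip i A)\<bar>) + (X (flip i A))\<^sup>2) / 4)
        = (\<Sum>A\<in>Pow I. ((X A)\<^sup>2 - \<bar>X A\<bar> * \<bar>X (flip i A)\<bar>) / 2)"
      unfolding sum_divide_distrib[symmetric] sum.distrib sum_subtractf sum_distrib_left[symmetric]
      by simp
  qed
  also have "\<dots> = (\<Sum>A\<in>Pow I. \<bar>X A\<bar> * (real (card I) * \<bar>X A\<bar> - (\<Sum>i\<in>I. \<bar>X (flip i A)\<bar>)) / 2)"
  proof -
    have *: "\<bar>x\<bar> * (\<bar>x\<bar> * c) = x * (x * c)" for x c :: real
      by (simp flip: mult.assoc)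
    show ?thesis
      by (subst sum.swap) (simp add: * sum_subtractf sum_distrib_left right_diff_distrib power2_eq_square
          mult_ac flip: sum_divide_distrib)
  qed
  also have "\<dots> \<le> (\<Sum>A\<in>Pow I. (X A)\<^sup>2)"
  proof (intro sum_mono)
    fix A
    have "real (card I) * \<bar>X A\<bar> - (\<Sum>i\<in>I. \<bar>X (flip i A)\<bar>) \<le> 2 * \<bar>X A\<bar>"
      using flips[of A] by (simp add: algebra_simps)
    then show "\<bar>X A\<bar> * (real (card I) * \<bar>X A\<bar> - (\<Sum>i\<in>I. \<bar>X (flip i A)\<bar>)) / 2 \<le> (X A)\<^sup>2"
      using mult_left_mono[of _ "2 * \<bar>X A\<bar>" "\<bar>X A\<bar>"] by (fastforce simp: power2_eq_square)
  qed
  finally have "2 * (\<Sum>A\<in>Pow I. (X A)\<^sup>2) - 2 * (\<Sum>A\<in>Pow I. \<bar>X A\<bar>)\<^sup>2 / 2 ^ card I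
      \<le> (\<Sum>A\<in>Pow I. (X A)\<^sup>2)"
    using cube_poincare[OF assms, of "\<lambda>A. \<bar>X A\<bar>"] even by simp
  then have "(\<Sum>i\<in>I. (b i)\<^sup>2) / 2 \<le> ((\<Sum>A\<in>Pow I. \<bar>X A\<bar>) / 2 ^ card I)\<^sup>2"
    using sum_Pow_sgn_square[OF assms, of b]
    by (simp add: X_def[symmetric] field_simps power2_eq_square)
  then show ?thesis
    unfolding X_def real_sqrt_divide[symmetric]
    by (intro real_le_lsqrt) (auto intro!: sum_nonneg divide_nonneg_nonneg)
qed

subsection \<open>Decomposition of the law\<close>

text \<open>A subset of \<open>I \<times> UNIV\<close> encodes two fair signs for each index; this
  is the factor \<open>(\<epsilon> + \<epsilon>') / 2\<close>.\<close>

definition half_sgn :: "('i \<times> bool) set \<Rightarrow> 'i \<Rightarrow> real" where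
  "half_sgn A i = (sgn_of A (i, True) + sgn_of A (i, False)) / 2"

text \<open>The four sign pairs at \<open>k\<close> give the factors 1, 0, 0, -1. The bracketing
  matches the integrand of \<open>nn_integral_weight\<close>.\<close>

lemma sum_half_sgn_insert:
  fixes G :: "real \<Rightarrow> 'b::comm_monoid_add"
  assumes "finite I" "k \<notin> I"
  shows "(\<Sum>A\<in>Pow (insert k I \<times> UNIV). G (\<Sum>i\<in>insert k I. c i * half_sgn A i))
    = (\<Sum>A\<in>Pow (I \<times> UNIV). G (c k + (\<Sum>i\<in>I. c i * half_sgn A i)) + G (\<Sum>i\<in>I. c i * half_sgn A i)
        + (G (\<Sum>i\<in>I. c i * half_sgn A i) + G (- c k + (\<Sum>i\<in>I. c i * half_sgn A i))))"
proof -
  let ?t = "(k, True)" and ?f = "(k, False)"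
  have "insert k I \<times> UNIV = insert ?t (insert ?f (I \<times> UNIV))"
    by (auto simp: UNIV_bool)
  moreover have "finite (I \<times> (UNIV :: bool set))" "?f \<notin> I \<times> UNIV" "?t \<notin> insert ?f (I \<times> UNIV)"
    using assms by auto
  moreover have "(\<Sum>i\<in>I. c i * half_sgn (insert ?t A) i) = (\<Sum>i\<in>I. c i * half_sgn A i)"
      "(\<Sum>i\<in>I. c i * half_sgn (insert ?f A) i) = (\<Sum>i\<in>I. c i * half_sgn A i)" for A
    using assms(2) by (auto simp: half_sgn_def sgn_of_def intro!: sum.cong)
  moreover have half: "half_sgn A k = - 1" "half_sgn (insert ?t A) k = 0" "half_sgn (insert ?f A) k = 0"
      "half_sgn (insert ?t (insert ?f A)) k = 1" if "A \<in> Pow (I \<times> UNIV)" for A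
    using that assms(2) by (auto simp: half_sgn_def sgn_of_def)
  ultimately show ?thesis
    using assms by (auto simp: sum_Pow_insert half ac_simps intro!: sum.cong)
qed

text \<open>Szarek's inequality with each coefficient \<open>c i / 2\<close> occurring twice: the
  squares sum to half of those of \<open>c\<close>, and this factor joins the constant
  \<open>1 / sqrt 2\<close> to give 1/2.\<close>

lemma sum_half_sgn_ge:
  fixes c :: "'i \<Rightarrow> real"
  assumes "finite I"
  shows "4 ^ card I / 2 * sqrt (\<Sum>i\<in>I. (c i)\<^sup>2)
    \<le> (\<Sum>A\<in>Pow (I \<times> UNIV). \<bar>\<Sum>i\<in>I. c i * half_sgn A i\<bar>)"
proof -
  let ?b = "\<lambda>p. c (fst p) / 2"
  have fin: "finite (I \<times> (UNIV :: bool set))"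
    using assms by simp
  have "(\<Sum>p\<in>I \<times> UNIV. ?b p * sgn_of A p) = (\<Sum>i\<in>I. c i * half_sgn A i)" for A
    by (simp add: sum.cartesian_product' UNIV_bool half_sgn_def field_simps)
  moreover have "(\<Sum>p\<in>I \<times> (UNIV :: bool set). (?b p)\<^sup>2) = (\<Sum>i\<in>I. (c i)\<^sup>2) / 2"
    by (simp add: sum.cartesian_product' UNIV_bool power_divide sum_divide_distrib)
  moreover have "(2::real) ^ card (I \<times> (UNIV :: bool set)) = 4 ^ card I"
    by (simp add: card_cartesian_product power_mult mult.commute[of _ 2])
  ultimately have "sqrt ((\<Sum>i\<in>I. (c i)\<^sup>2) / 2) / sqrt 2
      \<le> (\<Sum>A\<in>Pow (I \<times> UNIV). \<bar>\<Sum>i\<in>I. c i * half_sgn A i\<bar>) / 4 ^ card I"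
    using szarek[OF fin, of ?b] by (simp only:)
  moreover have "sqrt ((\<Sum>i\<in>I. (c i)\<^sup>2) / 2) / sqrt 2 = sqrt (\<Sum>i\<in>I. (c i)\<^sup>2) / 2"
    by (simp add: real_sqrt_divide)
  ultimately show ?thesis
    by (simp add: field_simps)
qed

text \<open>The density of the law of \<open>R\<close> with respect to the law of \<open>Y\<close>, divided by 4, the number of values
of the pair of signs.\<close>

definition weight :: "real \<Rightarrow> real \<Rightarrow> real" where
  "weight \<rho> y = (if y = 0 then (2 * \<rho> - 1) / (4 * \<rho>) else 1 / 2)"

lemma measurable_weight [measurable]: "weight \<rho> \<in> borel_measurable borel"
  unfolding weight_def[abs_def] by measurable

text \<open>The identity in law of \<open>Y\<close> with
  \<open>R (\<epsilon> + \<epsilon>') / 2\<close>, tested against \<open>h\<close>; the four terms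
  are the four sign pairs. The bound \<open>1 / 2 \<le> \<rho>\<close> keeps the density of
  \<open>R\<close> nonnegative at 0.\<close>

lemma nn_integral_weight:
  fixes \<mu> :: "real measure" and h :: "real \<Rightarrow> ennreal"
  assumes "prob_space \<mu>" and sets [measurable_cong]: "sets \<mu> = sets borel"
    and sym: "distr \<mu> borel uminus = \<mu>"
    and atom: "measure \<mu> {0} = \<rho>" and rho: "1 / 2 \<le> \<rho>" "\<rho> < 1"
    and h [measurable]: "h \<in> borel_measurable borel"
  shows "(\<integral>\<^sup>+y. h y \<partial>\<mu>) = (\<integral>\<^sup>+y. ennreal (weight \<rho> y) * (h y + h 0 + (h 0 + h (- y))) \<partial>\<mu>)"
proof -
  interpret prob_space \<mu> by fact
  have space: "space \<mu> = UNIV"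
    using sets_eq_imp_space_eq[OF sets] by simp
  have half: "ennreal (1/2) * x + ennreal (1/2) * x = x" for x
  proof -
    have "ennreal (1/2) + ennreal (1/2) = 1"
      using ennreal_plus[of "1/2" "1/2"] by simp
    then show ?thesis
      by (metis distrib_right mult_1)
  qed
  define g where "g y = h y * indicator (- {0}) y" for y
  have g [measurable]: "g \<in> borel_measurable borel"
    unfolding g_def[abs_def] by measurable
  have e0: "emeasure \<mu> {0} = ennreal \<rho>"
    using atom by (simp add: emeasure_eq_measure)
  have "measure \<mu> (- {0}) = 1 - \<rho>"
    using prob_compl[of "{0}"] atom space by (simp add: sets Compl_eq_Diff_UNIV)
  then have e1: "emeasure \<mu> (- {0}) = ennreal (1 - \<rho>)"
    by (simp add: emeasure_eq_measure)
  have neg: "(\<integral>\<^sup>+y. g (- y) \<partial>\<mu>) = (\<integral>\<^sup>+y. g y \<partial>\<mu>)"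
  proof -
    have "(\<integral>\<^sup>+y. g y \<partial>\<mu>) = (\<integral>\<^sup>+y. g y \<partial>distr \<mu> borel uminus)"
      using sym by simp
    also have "\<dots> = (\<integral>\<^sup>+y. g (- y) \<partial>\<mu>)"
      by (rule nn_integral_distr) auto
    finally show ?thesis ..
  qed
  have "(\<integral>\<^sup>+y. h y \<partial>\<mu>) = (\<integral>\<^sup>+y. h 0 * indicator {0} y + g y \<partial>\<mu>)"
    by (intro nn_integral_cong) (auto simp: g_def split: split_indicator)
  also have "\<dots> = h 0 * ennreal \<rho> + (\<integral>\<^sup>+y. g y \<partial>\<mu>)"
    by (simp add: nn_integral_add nn_integral_cmult_indicator e0 sets)
  \<comment> \<open>The mass at 0 has two sources: \<open>2 * \<rho> - 1\<close> from
    \<open>R = 0\<close>, and \<open>1 - \<rho>\<close> from opposite signs when \<open>R\<close> is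
    nonzero.\<close>
  also have "h 0 * ennreal \<rho> = h 0 * ennreal ((2 * \<rho> - 1) / \<rho>) * ennreal \<rho> + h 0 * ennreal (1 - \<rho>)"
  proof -
    have "ennreal \<rho> = ennreal ((2 * \<rho> - 1) / \<rho>) * ennreal \<rho> + ennreal (1 - \<rho>)"
      using rho by (simp flip: ennreal_mult ennreal_plus)
    then show ?thesis
      by (metis distrib_left mult.assoc)
  qed
  also have "\<dots> + (\<integral>\<^sup>+y. g y \<partial>\<mu>)
      = h 0 * ennreal ((2 * \<rho> - 1) / \<rho>) * ennreal \<rho> + h 0 * ennreal (1 - \<rho>)
        + (ennreal (1/2) * (\<integral>\<^sup>+y. g y \<partial>\<mu>) + ennreal (1/2) * (\<integral>\<^sup>+y. g (- y) \<partial>\<mu>))"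
    unfolding neg half ..
  also have "\<dots> = (\<integral>\<^sup>+y. h 0 * ennreal ((2 * \<rho> - 1) / \<rho>) * indicator {0} y + h 0 * indicator (- {0}) y
        + (ennreal (1/2) * g y + ennreal (1/2) * g (- y)) \<partial>\<mu>)"
    by (simp add: nn_integral_add nn_integral_cmult nn_integral_cmult_indicator e0 e1 sets)
  also have "\<dots> = (\<integral>\<^sup>+y. ennreal (weight \<rho> y) * (h y + h 0 + (h 0 + h (- y))) \<partial>\<mu>)"
  proof (intro nn_integral_cong)
    fix y
    have four: "ennreal ((2 * \<rho> - 1) / \<rho>) = ennreal ((2 * \<rho> - 1) / (4 * \<rho>)) * 4"
      using rho by (subst ennreal_numeral[symmetric], subst ennreal_mult[symmetric]) (auto simp: field_simps)
    show "h 0 * ennreal ((2 * \<rho> - 1) / \<rho>) * indicator {0} y + h 0 * indicator (- {0}) y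
        + (ennreal (1/2) * g y + ennreal (1/2) * g (- y))
        = ennreal (weight \<rho> y) * (h y + h 0 + (h 0 + h (- y)))"
    proof (cases "y = 0")
      case True
      have "h 0 + h 0 + (h 0 + h 0) = 4 * h 0"
        by (simp add: mult_2[symmetric] flip: mult.assoc)
      then show ?thesis
        using True four by (simp add: g_def weight_def mult_ac)
    next
      case False
      then show ?thesis
        using half[of "h 0"] by (simp add: g_def weight_def distrib_left ac_simps)
    qed
  qed
  finally show ?thesis .
qed

text \<open>Decomposes one coordinate after another. \<open>\<phi>\<close> varies in the induction
  because fixing coordinate \<open>k\<close> translates it by \<open>a k * t\<close>.\<close>

lemma nn_integral_PiM_weight:
  fixes \<mu> :: "real measure" and \<phi> :: "real \<Rightarrow> ennreal" and a :: "'i \<Rightarrow> real"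
  assumes "prob_space \<mu>" and sets [measurable_cong]: "sets \<mu> = sets borel"
    and sym: "distr \<mu> borel uminus = \<mu>"
    and atom: "measure \<mu> {0} = \<rho>" and rho: "1 / 2 \<le> \<rho>" "\<rho> < 1"
    and "finite I" and "\<phi> \<in> borel_measurable borel"
  shows "(\<integral>\<^sup>+y. \<phi> (\<Sum>i\<in>I. a i * y i) \<partial>Pi\<^sub>M I (\<lambda>_. \<mu>))
    = (\<integral>\<^sup>+y. (\<Prod>i\<in>I. ennreal (weight \<rho> (y i)))
         * (\<Sum>A\<in>Pow (I \<times> UNIV). \<phi> (\<Sum>i\<in>I. a i * y i * half_sgn A i)) \<partial>Pi\<^sub>M I (\<lambda>_. \<mu>))"
  using assms(7,8)
proof (induction I arbitrary: \<phi> rule: finite_induct)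
  case empty
  then show ?case by simp
next
  case (insert k I)
  interpret prob_space \<mu> by fact
  let ?P = "Pi\<^sub>M I (\<lambda>_. \<mu>)"
  interpret product_sigma_finite "\<lambda>_::'i. \<mu>" ..
  interpret P: sigma_finite_measure ?P
    using insert(1) by (rule sigma_finite)
  note [measurable] = insert.prems
  have meas1: "(\<lambda>y. \<phi> (\<Sum>i\<in>J. a i * y i)) \<in> borel_measurable (Pi\<^sub>M J (\<lambda>_. \<mu>))"
    and meas2: "(\<lambda>y. (\<Prod>i\<in>J. ennreal (weight \<rho> (y i)))
        * (\<Sum>A\<in>Pow (J \<times> UNIV). \<phi> (\<Sum>i\<in>J. a i * y i * half_sgn A i)))
      \<in> borel_measurable (Pi\<^sub>M J (\<lambda>_. \<mu>))" for J
  proof -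
    have lin: "(\<lambda>y. \<Sum>i\<in>J. a i * y i * c i) \<in> borel_measurable (Pi\<^sub>M J (\<lambda>_. \<mu>))" for c
      by measurable
    show "(\<lambda>y. \<phi> (\<Sum>i\<in>J. a i * y i)) \<in> borel_measurable (Pi\<^sub>M J (\<lambda>_. \<mu>))"
      using measurable_compose[OF lin[of "\<lambda>_. 1"] insert.prems] by simp
    show "(\<lambda>y. (\<Prod>i\<in>J. ennreal (weight \<rho> (y i)))
        * (\<Sum>A\<in>Pow (J \<times> UNIV). \<phi> (\<Sum>i\<in>J. a i * y i * half_sgn A i)))
      \<in> borel_measurable (Pi\<^sub>M J (\<lambda>_. \<mu>))"
      by (intro borel_measurable_times_ennreal borel_measurable_sum measurable_compose[OF lin insert.prems])
        measurable
  qed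
  define S where "S A y = (\<Sum>i\<in>I. a i * y i * half_sgn A i)" for A and y :: "'i \<Rightarrow> real"
  define W where "W y = (\<Prod>i\<in>I. ennreal (weight \<rho> (y i)))" for y
  define K where "K t x = W x * (\<Sum>A\<in>Pow (I \<times> UNIV). \<phi> (a k * t + S A x))" for t x
  have K: "K t \<in> borel_measurable ?P" for t
    unfolding K_def[abs_def] W_def S_def by measurable
  \<comment> \<open>\<open>H t\<close> integrates out the coordinates in \<open>I\<close>, already
    decomposed, with value \<open>t\<close> at \<open>k\<close>. It is the test function to which
    \<open>nn_integral_weight\<close> is applied.\<close>
  define H where "H t = (\<integral>\<^sup>+x. K t x \<partial>?P)" for t
  have H [measurable]: "H \<in> borel_measurable borel"
    unfolding H_def[abs_def] K_def W_def S_def by measurable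
  have upd: "(\<Sum>i\<in>insert k I. a i * (x(k := t)) i) = a k * t + (\<Sum>i\<in>I. a i * x i)" for x t
  proof -
    have "(\<Sum>i\<in>I. a i * (x(k := t)) i) = (\<Sum>i\<in>I. a i * x i)"
      using insert(2) by (intro sum.cong) auto
    then show ?thesis using insert(1,2) by simp
  qed
  have updW: "(\<Prod>i\<in>insert k I. ennreal (weight \<rho> ((x(k := t)) i))) = ennreal (weight \<rho> t) * W x" for x t
  proof -
    have "(\<Prod>i\<in>I. ennreal (weight \<rho> ((x(k := t)) i))) = W x"
      unfolding W_def using insert(2) by (intro prod.cong) auto
    then show ?thesis using insert(1,2) by simp
  qed
  \<comment> \<open>The product \<open>a k * 0\<close> stays unevaluated so that the four sums are
    recognised as those of \<open>K t\<close>, \<open>K 0\<close>, \<open>K 0\<close> and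
    \<open>K (- t)\<close>.\<close>
  have updS: "(\<Sum>A\<in>Pow (insert k I \<times> UNIV). \<phi> (\<Sum>i\<in>insert k I. a i * (x(k := t)) i * half_sgn A i))
      = (\<Sum>A\<in>Pow (I \<times> UNIV). \<phi> (a k * t + S A x)) + (\<Sum>A\<in>Pow (I \<times> UNIV). \<phi> (a k * 0 + S A x))
        + ((\<Sum>A\<in>Pow (I \<times> UNIV). \<phi> (a k * 0 + S A x))
        + (\<Sum>A\<in>Pow (I \<times> UNIV). \<phi> (a k * (- t) + S A x)))" for x t
  proof -
    have "(\<Sum>i\<in>I. a i * (x(k := t)) i * half_sgn A i) = S A x" for A
      unfolding S_def using insert(2) by (intro sum.cong) auto
    then show ?thesis
      unfolding sum_half_sgn_insert[OF insert(1,2), of \<phi>] sum.distrib[symmetric]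
      by (simp only: fun_upd_same mult_zero_right add_0 mult_minus_right)
  qed
  have inner: "(\<integral>\<^sup>+x. (\<Prod>i\<in>insert k I. ennreal (weight \<rho> ((x(k := t)) i)))
         * (\<Sum>A\<in>Pow (insert k I \<times> UNIV). \<phi> (\<Sum>i\<in>insert k I. a i * (x(k := t)) i * half_sgn A i)) \<partial>?P)
      = ennreal (weight \<rho> t) * (H t + H 0 + (H 0 + H (- t)))" for t
    unfolding updW updS unfolding mult.assoc distrib_left[of "W _"] K_def[symmetric] H_def
    by (simp only: nn_integral_cmult nn_integral_add K borel_measurable_add)
  have "(\<integral>\<^sup>+y. \<phi> (\<Sum>i\<in>insert k I. a i * y i) \<partial>Pi\<^sub>M (insert k I) (\<lambda>_. \<mu>))
      = (\<integral>\<^sup>+t. \<integral>\<^sup>+x. \<phi> (\<Sum>i\<in>insert k I. a i * (x(k := t)) i) \<partial>?P \<partial>\<mu>)"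
    by (rule product_nn_integral_insert_rev[OF insert(1,2) meas1])
  also have "\<dots> = (\<integral>\<^sup>+t. H t \<partial>\<mu>)"
    unfolding upd H_def K_def W_def S_def by (intro nn_integral_cong insert.IH) measurable
  also have "\<dots> = (\<integral>\<^sup>+t. ennreal (weight \<rho> t) * (H t + H 0 + (H 0 + H (- t))) \<partial>\<mu>)"
    by (rule nn_integral_weight) (use assms H in auto)
  also have "\<dots> = (\<integral>\<^sup>+t. \<integral>\<^sup>+x. (\<Prod>i\<in>insert k I. ennreal (weight \<rho> ((x(k := t)) i)))
         * (\<Sum>A\<in>Pow (insert k I \<times> UNIV). \<phi> (\<Sum>i\<in>insert k I. a i * (x(k := t)) i * half_sgn A i)) \<partial>?P \<partial>\<mu>)"
    by (simp only: inner)
  also have "\<dots> = (\<integral>\<^sup>+y. (\<Prod>i\<in>insert k I. ennreal (weight \<rho> (y i)))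
         * (\<Sum>A\<in>Pow (insert k I \<times> UNIV). \<phi> (\<Sum>i\<in>insert k I. a i * y i * half_sgn A i))
         \<partial>Pi\<^sub>M (insert k I) (\<lambda>_. \<mu>))"
    by (rule product_nn_integral_insert_rev[OF insert(1,2) meas2, symmetric])
  finally show ?case .
qed

subsection \<open>Moments of sums of independent variables\<close>

lemma ennreal_sum_mult:
  assumes "\<And>i. i \<in> I \<Longrightarrow> 0 \<le> f i" "\<And>i. i \<in> I \<Longrightarrow> 0 \<le> g i"
  shows "ennreal (\<Sum>i\<in>I. f i * g i) = (\<Sum>i\<in>I. ennreal (f i) * ennreal (g i))"
proof -
  have "ennreal (\<Sum>i\<in>I. f i * g i) = (\<Sum>i\<in>I. ennreal (f i * g i))"
    by (rule sum_ennreal[symmetric]) (simp add: assms)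
  also have "\<dots> = (\<Sum>i\<in>I. ennreal (f i) * ennreal (g i))"
    by (rule sum.cong[OF refl]) (simp add: assms ennreal_mult)
  finally show ?thesis .
qed

text \<open>After decomposition the integrand has a lower bound linear in the
  \<open>\<bar>y i\<bar>\<close>, which integrates coordinate by coordinate. In
  \<open>[0, \<infinity>]\<close> no moment has to be finite.\<close>

lemma khinchin_PiM:
  fixes \<mu> :: "real measure" and a :: "'i \<Rightarrow> real"
  assumes "prob_space \<mu>" and sets [measurable_cong]: "sets \<mu> = sets borel"
    and sym: "distr \<mu> borel uminus = \<mu>"
    and atom: "measure \<mu> {0} = \<rho>" and rho: "1 / 2 \<le> \<rho>" "\<rho> < 1"
    and "finite I"
  shows "ennreal (sqrt (\<Sum>i\<in>I. (a i)\<^sup>2)) * (\<integral>\<^sup>+y. ennreal \<bar>y\<bar> \<partial>\<mu>)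
    \<le> (\<integral>\<^sup>+y. ennreal \<bar>\<Sum>i\<in>I. a i * y i\<bar> \<partial>Pi\<^sub>M I (\<lambda>_. \<mu>))"
proof (cases "(\<Sum>i\<in>I. (a i)\<^sup>2) = 0")
  case True
  then show ?thesis by simp
next
  case False
  interpret prob_space \<mu> by fact
  interpret product_sigma_finite "\<lambda>_::'i. \<mu>" ..
  let ?P = "Pi\<^sub>M I (\<lambda>_. \<mu>)"
  define L where "L = sqrt (\<Sum>i\<in>I. (a i)\<^sup>2)"
  define E where "E = (\<integral>\<^sup>+y. ennreal \<bar>y\<bar> \<partial>\<mu>)"
  define v where "v y = ennreal (weight \<rho> y)" for y
  \<comment> \<open>The coefficient of \<open>\<bar>y i\<bar>\<close> when the square root in
    \<open>sum_half_sgn_ge\<close> is bounded below by Cauchy-Schwarz.\<close>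
  define c where "c i = 4 ^ card I / 2 * ((a i)\<^sup>2 / L)" for i
  have v [measurable]: "v \<in> borel_measurable borel"
    unfolding v_def[abs_def] by measurable
  have "(\<Sum>i\<in>I. (a i)\<^sup>2) > 0"
    using False sum_nonneg[of I "\<lambda>i. (a i)\<^sup>2"] by simp
  then have L: "L > 0" "L * L = (\<Sum>i\<in>I. (a i)\<^sup>2)"
    by (simp_all add: L_def)
  have c: "c i \<ge> 0" for i
    using L by (simp add: c_def)
  \<comment> \<open>The test function 1 in \<open>nn_integral_weight\<close>: the four sign pairs
    share the total mass 1.\<close>
  have mass: "(\<integral>\<^sup>+y. v y \<partial>\<mu>) = ennreal (1 / 4)"
  proof -
    have "1 = (\<integral>\<^sup>+y. v y * (1 + 1 + (1 + 1)) \<partial>\<mu>)"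
      using nn_integral_weight[OF assms(1-6), of "\<lambda>_. 1"] by (simp add: v_def emeasure_space_1)
    also have "\<dots> = (\<integral>\<^sup>+y. v y \<partial>\<mu>) * (1 + 1 + (1 + 1))"
      by (rule nn_integral_multc) measurable
    also have "1 + 1 + (1 + 1) = ennreal 4"
      by simp
    finally have "1 * ennreal (1/4) = (\<integral>\<^sup>+y. v y \<partial>\<mu>) * (ennreal 4 * ennreal (1/4))"
      by (metis mult.assoc)
    also have "ennreal 4 * ennreal (1/4) = 1"
      by (subst ennreal_mult[symmetric]) simp_all
    finally show ?thesis by simp
  qed
  \<comment> \<open>The factor \<open>\<bar>y\<bar>\<close> vanishes at the atom, so the weight may
    be taken as 1/2 everywhere.\<close>
  have moment: "(\<integral>\<^sup>+y. v y * ennreal \<bar>y\<bar> \<partial>\<mu>) = ennreal (1 / 2) * E"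
  proof -
    have "v y * ennreal \<bar>y\<bar> = ennreal (1 / 2) * ennreal \<bar>y\<bar>" for y
      by (simp add: v_def weight_def)
    then show ?thesis
      unfolding E_def by (simp only:) (rule nn_integral_cmult, measurable)
  qed
  have single: "(\<integral>\<^sup>+y. (\<Prod>j\<in>I. v (y j)) * ennreal \<bar>y i\<bar> \<partial>?P) = ennreal ((1/4) ^ (card I - 1) * (1/2)) * E"
    if "i \<in> I" for i
  proof -
    have "(\<integral>\<^sup>+y. (\<Prod>j\<in>I. v (y j)) * ennreal \<bar>y i\<bar> \<partial>?P)
        = (\<integral>\<^sup>+y. (\<Prod>j\<in>I. v (y j) * (if j = i then ennreal \<bar>y j\<bar> else 1)) \<partial>?P)"
      using that \<open>finite I\<close> by (simp add: prod.distrib prod.delta)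
    also have "\<dots> = (\<Prod>j\<in>I. \<integral>\<^sup>+y. v y * (if j = i then ennreal \<bar>y\<bar> else 1) \<partial>\<mu>)"
      by (rule product_nn_integral_prod[OF \<open>finite I\<close>]) measurable
    also have "\<dots> = ennreal (1/2) * E * (\<Prod>j\<in>I - {i}. ennreal (1/4))"
      unfolding prod.remove[OF \<open>finite I\<close> that] by (intro arg_cong2[where f = "(*)"] prod.cong)
        (auto simp: mass moment)
    also have "\<dots> = ennreal ((1/4) ^ (card I - 1) * (1/2)) * E"
    proof -
      have "ennreal ((1/4) ^ (card I - 1) * (1/2)) = ennreal ((1/4) ^ (card I - 1)) * ennreal (1/2)"
        by (rule ennreal_mult) simp_all
      then show ?thesis
        using that \<open>finite I\<close> by (simp only: prod_constant card_Diff_singleton ennreal_power) (simp add: mult_ac)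
    qed
    finally show ?thesis .
  qed
  have pointwise: "(\<Sum>i\<in>I. c i * \<bar>y i\<bar>) \<le> (\<Sum>A\<in>Pow (I \<times> UNIV). \<bar>\<Sum>i\<in>I. a i * y i * half_sgn A i\<bar>)" for y
  proof -
    \<comment> \<open>Pairing \<open>a i\<close> with \<open>a i * y i\<close> makes the bound
      linear in \<open>\<bar>y i\<bar>\<close> with weights \<open>(a i)\<^sup>2\<close>.\<close>
    have CS: "(\<Sum>i\<in>I. \<bar>a i\<bar> * \<bar>a i * y i\<bar>) \<le> L * sqrt (\<Sum>i\<in>I. (a i * y i)\<^sup>2)"
      using L2_set_mult_ineq[of a "\<lambda>i. a i * y i" I] by (simp add: L_def L2_set_def)
    have "(\<Sum>i\<in>I. (a i)\<^sup>2 * \<bar>y i\<bar>) / L \<le> sqrt (\<Sum>i\<in>I. (a i * y i)\<^sup>2)"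
    proof -
      have "\<bar>a i\<bar> * \<bar>a i * y i\<bar> = (a i)\<^sup>2 * \<bar>y i\<bar>" for i
        by (simp add: abs_mult power2_eq_square flip: mult.assoc)
      then show ?thesis
        using L CS by (simp add: pos_divide_le_eq mult.commute)
    qed
    then have "4 ^ card I / 2 * ((\<Sum>i\<in>I. (a i)\<^sup>2 * \<bar>y i\<bar>) / L)
        \<le> 4 ^ card I / 2 * sqrt (\<Sum>i\<in>I. (a i * y i)\<^sup>2)"
      by (intro mult_left_mono) auto
    also note sum_half_sgn_ge[OF \<open>finite I\<close>, of "\<lambda>i. a i * y i"]
    finally show ?thesis
      by (simp add: c_def sum_distrib_left sum_divide_distrib mult_ac)
  qed
  have "ennreal L * E = (\<Sum>i\<in>I. ennreal (c i) * (ennreal ((1/4) ^ (card I - 1) * (1/2)) * E))"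
  proof -
    \<comment> \<open>The powers of 4 and the two halves cancel exactly, leaving the squares of
      \<open>a\<close> over \<open>L\<close>. A nonzero \<open>a\<close> makes \<open>I\<close>
      nonempty, so \<open>card I - 1\<close> is a true predecessor.\<close>
    have "L = (\<Sum>i\<in>I. c i * ((1/4) ^ (card I - 1) * (1/2)))"
    proof -
      have "card I > 0"
        using False \<open>finite I\<close> by (auto simp: card_gt_0_iff)
      then have "(4::real) ^ card I = 4 * 4 ^ (card I - 1)"
        by (simp flip: power_Suc)
      then have "c i * ((1/4) ^ (card I - 1) * (1/2)) = (a i)\<^sup>2 / L" for i
        by (simp add: c_def power_one_over)
      then have "(\<Sum>i\<in>I. c i * ((1/4) ^ (card I - 1) * (1/2))) = L * L / L"
        unfolding L(2) by (simp only: sum_divide_distrib)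
      then show ?thesis
        using L(1) by simp
    qed
    also have "ennreal \<dots> = (\<Sum>i\<in>I. ennreal (c i) * ennreal ((1/4) ^ (card I - 1) * (1/2)))"
      by (rule ennreal_sum_mult) (use c in simp_all)
    finally show ?thesis
      by (simp only: sum_distrib_right mult.assoc)
  qed
  also have "\<dots> = (\<Sum>i\<in>I. ennreal (c i) * (\<integral>\<^sup>+y. (\<Prod>j\<in>I. v (y j)) * ennreal \<bar>y i\<bar> \<partial>?P))"
    by (simp add: single)
  also have "\<dots> = (\<integral>\<^sup>+y. (\<Sum>i\<in>I. ennreal (c i) * ((\<Prod>j\<in>I. v (y j)) * ennreal \<bar>y i\<bar>)) \<partial>?P)"
  proof -
    have m: "(\<lambda>y. (\<Prod>j\<in>I. v (y j)) * ennreal \<bar>y i\<bar>) \<in> borel_measurable ?P" if "i \<in> I" for i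
      using that by measurable
    show ?thesis
      by (subst nn_integral_sum) (simp_all only: nn_integral_cmult m borel_measurable_times_ennreal
          measurable_const space_borel UNIV_I cong: sum.cong)
  qed
  also have "\<dots> = (\<integral>\<^sup>+y. (\<Prod>i\<in>I. v (y i)) * ennreal (\<Sum>i\<in>I. c i * \<bar>y i\<bar>) \<partial>?P)"
  proof -
    have "ennreal (\<Sum>i\<in>I. c i * \<bar>y i\<bar>) = (\<Sum>i\<in>I. ennreal (c i) * ennreal \<bar>y i\<bar>)" for y
      by (rule ennreal_sum_mult) (use c in simp_all)
    then show ?thesis
      by (simp only: sum_distrib_left mult.left_commute)
  qed
  also have "\<dots> \<le> (\<integral>\<^sup>+y. (\<Prod>i\<in>I. v (y i))
      * (\<Sum>A\<in>Pow (I \<times> UNIV). ennreal \<bar>\<Sum>i\<in>I. a i * y i * half_sgn A i\<bar>) \<partial>?P)"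
    by (intro nn_integral_mono mult_left_mono) (auto intro: ennreal_leI pointwise)
  also have "\<dots> = (\<integral>\<^sup>+y. ennreal \<bar>\<Sum>i\<in>I. a i * y i\<bar> \<partial>?P)"
    unfolding v_def
    by (rule nn_integral_PiM_weight[OF assms, of "\<lambda>x. ennreal \<bar>x\<bar>", symmetric]) measurable
  finally show ?thesis
    by (simp add: L_def E_def)
qed

text \<open>Off the diagonal, independence turns the mixed moment into a product of zero
  means.\<close>

lemma (in prob_space) second_moment_sum_indep:
  fixes X :: "'i \<Rightarrow> 'a \<Rightarrow> real"
  assumes "finite I" and indep: "indep_vars (\<lambda>_. borel) X I"
    and int: "\<And>i. i \<in> I \<Longrightarrow> integrable M (X i)"
    and sq: "\<And>i. i \<in> I \<Longrightarrow> integrable M (\<lambda>\<omega>. (X i \<omega>)\<^sup>2)"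
    and centred: "\<And>i. i \<in> I \<Longrightarrow> expectation (X i) = 0"
  shows "expectation (\<lambda>\<omega>. (\<Sum>i\<in>I. a i * X i \<omega>)\<^sup>2) = (\<Sum>i\<in>I. (a i)\<^sup>2 * expectation (\<lambda>\<omega>. (X i \<omega>)\<^sup>2))"
proof -
  have pair: "integrable M (\<lambda>\<omega>. X i \<omega> * X j \<omega>) \<and>
      expectation (\<lambda>\<omega>. X i \<omega> * X j \<omega>) = (if i = j then expectation (\<lambda>\<omega>. (X i \<omega>)\<^sup>2) else 0)"
    if ij: "i \<in> I" "j \<in> I" for i j
  proof (cases "i = j")
    case True
    then show ?thesis using sq[OF ij(1)] by (simp add: power2_eq_square)
  next
    case False
    have "indep_vars (\<lambda>_. borel) X {i, j}"
      using ij by (intro indep_vars_subset[OF indep]) auto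
    then have "integrable M (\<lambda>\<omega>. \<Prod>k\<in>{i, j}. X k \<omega>)"
      "expectation (\<lambda>\<omega>. \<Prod>k\<in>{i, j}. X k \<omega>) = (\<Prod>k\<in>{i, j}. expectation (X k))"
      using ij int by (auto intro!: indep_vars_integrable indep_vars_lebesgue_integral)
    then show ?thesis
      using False ij centred by simp
  qed
  have "expectation (\<lambda>\<omega>. (\<Sum>i\<in>I. a i * X i \<omega>)\<^sup>2)
      = expectation (\<lambda>\<omega>. \<Sum>i\<in>I. \<Sum>j\<in>I. (a i * a j) * (X i \<omega> * X j \<omega>))"
    by (simp add: power2_eq_square sum_product mult_ac)
  also have "\<dots> = (\<Sum>i\<in>I. \<Sum>j\<in>I. (a i * a j) * expectation (\<lambda>\<omega>. X i \<omega> * X j \<omega>))"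
    by (simp add: pair Bochner_Integration.integral_sum)
  also have "\<dots> = (\<Sum>i\<in>I. \<Sum>j\<in>I. if i = j then (a i)\<^sup>2 * expectation (\<lambda>\<omega>. (X i \<omega>)\<^sup>2) else 0)"
    by (rule sum.cong[OF refl], rule sum.cong[OF refl]) (simp add: pair power2_eq_square[of "a _"])
  also have "\<dots> = (\<Sum>i\<in>I. (a i)\<^sup>2 * expectation (\<lambda>\<omega>. (X i \<omega>)\<^sup>2))"
    using \<open>finite I\<close> by simp
  finally show ?thesis .
qed

text \<open>Carries \<open>khinchin_PiM\<close> over to random variables: the joint law of the
  \<open>X i\<close> is the product of their common law. Integrability of the law allows the return
  from \<open>[0, \<infinity>]\<close> to real expectations.\<close>

lemma (in prob_space) khinchin_indep:
  fixes X :: "'i \<Rightarrow> 'a \<Rightarrow> real"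
  assumes "finite I" "I \<noteq> {}" and indep: "indep_vars (\<lambda>_. borel) X I"
    and distr: "\<And>i. i \<in> I \<Longrightarrow> distr M borel (X i) = \<mu>"
    and sym: "distr \<mu> borel uminus = \<mu>"
    and atom: "measure \<mu> {0} = \<rho>" and rho: "1 / 2 \<le> \<rho>" "\<rho> < 1"
    and int: "integrable \<mu> (\<lambda>y. y)"
  shows "sqrt (\<Sum>i\<in>I. (a i)\<^sup>2) * (\<integral>y. \<bar>y\<bar> \<partial>\<mu>) \<le> expectation (\<lambda>\<omega>. \<bar>\<Sum>i\<in>I. a i * X i \<omega>\<bar>)"
proof -
  have rv [measurable]: "random_variable borel (X i)" if "i \<in> I" for i
    using indep that by (simp add: indep_vars_def)
  obtain i0 where "i0 \<in> I"
    using \<open>I \<noteq> {}\<close> by auto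
  then have mu: "prob_space \<mu>" "sets \<mu> = sets borel"
    using distr[of i0] prob_space_distr[OF rv] by auto
  note [measurable_cong] = mu(2)
  have intX: "integrable M (X i)" if "i \<in> I" for i
    using int that unfolding distr[OF that, symmetric] by (simp add: integrable_distr_eq)
  have S: "integrable M (\<lambda>\<omega>. \<Sum>i\<in>I. a i * X i \<omega>)"
    using intX by simp
  have joint: "distr M (\<Pi>\<^sub>M i\<in>I. borel) (\<lambda>\<omega>. \<lambda>i\<in>I. X i \<omega>) = (\<Pi>\<^sub>M i\<in>I. \<mu>)"
    using indep_vars_iff_distr_eq_PiM'[where I = I and M' = "\<lambda>_. borel" and X = X] indep \<open>I \<noteq> {}\<close> rv
    by (simp add: distr cong: PiM_cong)
  have "ennreal (sqrt (\<Sum>i\<in>I. (a i)\<^sup>2) * (\<integral>y. \<bar>y\<bar> \<partial>\<mu>))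
      = ennreal (sqrt (\<Sum>i\<in>I. (a i)\<^sup>2)) * (\<integral>\<^sup>+y. ennreal \<bar>y\<bar> \<partial>\<mu>)"
    using int by (subst nn_integral_eq_integral) (auto simp: ennreal_mult sum_nonneg)
  also have "\<dots> \<le> (\<integral>\<^sup>+y. ennreal \<bar>\<Sum>i\<in>I. a i * y i\<bar> \<partial>Pi\<^sub>M I (\<lambda>_. \<mu>))"
    by (rule khinchin_PiM[OF mu sym atom rho \<open>finite I\<close>])
  also have "\<dots> = (\<integral>\<^sup>+\<omega>. ennreal \<bar>\<Sum>i\<in>I. a i * (\<lambda>i\<in>I. X i \<omega>) i\<bar> \<partial>M)"
    unfolding joint[symmetric] by (rule nn_integral_distr) measurable
  also have "\<dots> = (\<integral>\<^sup>+\<omega>. ennreal \<bar>\<Sum>i\<in>I. a i * X i \<omega>\<bar> \<partial>M)"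
    by (simp cong: sum.cong)
  also have "\<dots> = ennreal (expectation (\<lambda>\<omega>. \<bar>\<Sum>i\<in>I. a i * X i \<omega>\<bar>))"
    using S by (intro nn_integral_eq_integral) auto
  finally show ?thesis
    by (subst (asm) ennreal_le_iff) (auto intro: integral_nonneg_AE)
qed

section \<open>The two norms and the best constant\<close>

lemma Lp_norm_1: "Lp_norm M 1 Z = (\<integral>\<omega>. \<bar>Z \<omega>\<bar> \<partial>M)"
  by (simp add: Lp_norm_def integral_nonneg_AE)

lemma Lp_norm_2: "Lp_norm M 2 Z = sqrt (\<integral>\<omega>. (Z \<omega>)\<^sup>2 \<partial>M)"
proof -
  have "\<bar>x\<bar> powr 2 = x\<^sup>2" for x :: real
    by (cases "x = 0") (simp_all add: powr_numeral)
  then show ?thesis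
    by (simp add: Lp_norm_def powr_half_sqrt integral_nonneg_AE)
qed

theorem theorem4:
  fixes M :: "'a measure" and Y :: "nat \<Rightarrow> 'a \<Rightarrow> real" and \<rho>\<^sub>0 :: real
  assumes "prob_space M"
    and "1 / 2 \<le> \<rho>\<^sub>0" and "\<rho>\<^sub>0 < 1"
    and "iid M Y"
    and "symmetric_rv M (Y 0)"
    and "measure M {\<omega> \<in> space M. Y 0 \<omega> = 0} = \<rho>\<^sub>0"
    and "integrable M (\<lambda>\<omega>. \<bar>Y 0 \<omega>\<bar> ^ 2)"
  shows "is_largest (Lp_norm M 1 (Y 0) / Lp_norm M 2 (Y 0))
           (\<lambda>c. \<forall>n\<ge>1. \<forall>a. N M Y 1 n a \<ge> c * N M Y 2 n a)"
proof -
  interpret prob_space M by fact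
  define \<mu> where "\<mu> = distr M borel (Y 0)"
  define m1 where "m1 = (\<integral>y. \<bar>y\<bar> \<partial>\<mu>)"
  define m2 where "m2 = (\<integral>y. y\<^sup>2 \<partial>\<mu>)"
  have indep: "indep_vars (\<lambda>_. borel) Y UNIV" and distr: "distr M borel (Y i) = \<mu>" for i
    using \<open>iid M Y\<close> by (auto simp: iid_def \<mu>_def)
  have rv [measurable]: "random_variable borel (Y i)" for i
    using indep by (simp add: indep_vars_def)
  interpret \<mu>: prob_space \<mu>
    unfolding \<mu>_def by (rule prob_space_distr[OF rv])
  have sets [measurable_cong]: "sets \<mu> = sets borel"
    by (simp add: \<mu>_def)
  have transfer: "expectation (\<lambda>\<omega>. g (Y i \<omega>)) = (\<integral>y. g y \<partial>\<mu>)"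
    if "g \<in> borel_measurable borel" for i and g :: "real \<Rightarrow> real"
    unfolding distr[of i, symmetric] by (rule integral_distr[OF rv that, symmetric])
  have transfer_int: "integrable \<mu> g \<longleftrightarrow> integrable M (\<lambda>\<omega>. g (Y i \<omega>))"
    if "g \<in> borel_measurable borel" for i and g :: "real \<Rightarrow> real"
    unfolding distr[of i, symmetric] by (rule integrable_distr_eq[OF rv that])
  have sym: "distr \<mu> borel uminus = \<mu>"
    using \<open>symmetric_rv M (Y 0)\<close> by (simp add: symmetric_rv_def \<mu>_def distr_distr comp_def)
  have atom: "measure \<mu> {0} = \<rho>\<^sub>0"
    using assms(6) by (simp add: \<mu>_def measure_distr vimage_def Int_def conj_commute)
  have sq: "integrable \<mu> (\<lambda>y. y\<^sup>2)"
    using assms(7) by (simp add: transfer_int[of _ 0])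
  have int: "integrable \<mu> (\<lambda>y. y)"
    by (rule \<mu>.square_integrable_imp_integrable[OF _ sq]) measurable
  have centred: "(\<integral>y. y \<partial>\<mu>) = 0"
  proof -
    have "(\<integral>y. y \<partial>\<mu>) = (\<integral>y. y \<partial>distr \<mu> borel uminus)"
      by (simp add: sym)
    also have "\<dots> = (\<integral>y. - y \<partial>\<mu>)"
      by (rule integral_distr) measurable
    finally show ?thesis by simp
  qed
  \<comment> \<open>Otherwise \<open>Y\<close> would vanish almost surely, against
    \<open>\<rho>\<^sub>0 < 1\<close>. This makes the quotient of norms meaningful.\<close>
  have m2: "m2 > 0"
  proof -
    have "m2 \<noteq> 0"
    proof
      assume "m2 = 0"
      then have "AE y in \<mu>. y = 0"
        using integral_nonneg_eq_0_iff_AE[OF sq] by (simp add: m2_def)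
      then have "measure \<mu> {0} = 1"
        by (subst \<mu>.prob_eq_1) (auto simp: sets)
      with atom \<open>\<rho>\<^sub>0 < 1\<close> show False by simp
    qed
    moreover have "m2 \<ge> 0"
      by (simp add: m2_def)
    ultimately show ?thesis by simp
  qed
  have intY: "integrable M (Y i)" for i
    using iffD1[OF transfer_int int, of i] by simp
  have sqY: "integrable M (\<lambda>\<omega>. (Y i \<omega>)\<^sup>2)" for i
    by (rule iffD1[OF transfer_int sq]) simp
  have centredY: "expectation (Y i) = 0" for i
    using transfer[of "\<lambda>y. y" i] centred by simp
  have absY: "expectation (\<lambda>\<omega>. \<bar>Y i \<omega>\<bar>) = m1" for i
    unfolding m1_def by (rule transfer) simp
  have momY: "expectation (\<lambda>\<omega>. (Y i \<omega>)\<^sup>2) = m2" for i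
    unfolding m2_def by (rule transfer) simp
  have norm1: "Lp_norm M 1 (Y i) = m1" and norm2: "Lp_norm M 2 (Y i) = sqrt m2" for i
    by (simp_all add: Lp_norm_1 Lp_norm_2 absY momY)
  have N2: "N M Y 2 n a = sqrt (\<Sum>i=1..n. (a i)\<^sup>2) * sqrt m2" for n a
  proof -
    have "expectation (\<lambda>\<omega>. (\<Sum>i=1..n. a i * Y i \<omega>)\<^sup>2)
        = (\<Sum>i=1..n. (a i)\<^sup>2 * expectation (\<lambda>\<omega>. (Y i \<omega>)\<^sup>2))"
      by (rule second_moment_sum_indep[OF _ indep_vars_subset[OF indep subset_UNIV] intY sqY centredY]) simp
    also have "\<dots> = (\<Sum>i=1..n. (a i)\<^sup>2) * m2"
      unfolding momY by (rule sum_distrib_right[symmetric])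
    finally show ?thesis
      by (simp add: N_def Lp_norm_2 real_sqrt_mult)
  qed
  have N1: "sqrt (\<Sum>i=1..n. (a i)\<^sup>2) * m1 \<le> N M Y 1 n a" if "n \<ge> 1" for n a
    unfolding N_def Lp_norm_1 m1_def using that
    by (intro khinchin_indep[OF _ _ _ _ sym atom assms(2,3) int] indep_vars_subset[OF indep] distr) auto
  show ?thesis
    unfolding is_largest_def norm1 norm2
  proof (intro conjI allI impI)
    show "m1 / sqrt m2 * N M Y 2 n a \<le> N M Y 1 n a" if "n \<ge> 1" for n a
      using N1[OF that, of a] m2 by (simp add: N2 mult.commute)
    show "c \<le> m1 / sqrt m2" if c: "\<forall>n\<ge>1. \<forall>a. c * N M Y 2 n a \<le> N M Y 1 n a" for c
    proof -
      \<comment> \<open>With \<open>n = 1\<close> and coefficient 1 the sum is \<open>Y 1\<close>,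
        not \<open>Y 0\<close>; \<open>norm1\<close> and \<open>norm2\<close> hold for every index,
        so both norms are those of the common law.\<close>
      have "c * N M Y 2 1 (\<lambda>_. 1) \<le> N M Y 1 1 (\<lambda>_. 1)"
        using c by blast
      then have "c * sqrt m2 \<le> m1"
        by (simp add: N_def norm1 norm2)
      then show ?thesis
        using m2 by (simp add: pos_le_divide_eq)
    qed
  qed
qed

end
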